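(* Let $Y\subseteq\mathbb{U}^*$ be a cycle property, let $\mathcal{A}$ be an arena with labels in $\mathbb{U}$, and let $O\subseteq\mathrm{plays}(\mathcal{A})$ be such that the game $(\mathcal{A},O)$ is $Y$-greedy. Let $i\in\{0,1\}$. Then: (1) the winning region of Player $i$ in the game $(\mathcal{A},O)$ coincides with the winning region of Player $i$ in the game $(\mathcal{A},O_{\mathrm{FC}(Y)}(\mathcal{A}))$; (2) for every vertex $v$ and every memoryless strategy $S$ for Player $i$, $S$ is winning from $v$ in $(\mathcal{A},O)$ if and only if $S$ is winning from $v$ in $(\mathcal{A},O_{\mathrm{FC}(Y)}(\mathcal{A}))$.
   Context: An arena is a tuple $\mathcal{A}=(V_0,V_1,E,\mathbb{U},\lambda)$ where $V_0,V_1$ are disjoint finite sets (the vertices of Player 0 and Player 1) with $V:=V_0\cup V_1$ non-empty, $E\subseteq V\times V$ is a set of edges such that every vertex has at least one outgoing edge, $\mathbb{U}$ is a set of labels, and $\lambda:E\to\mathbb{U}$. For a sequence of edges $u=e_1e_2\cdots$, write $\lambda(u)=\lambda(e_1)\lambda(e_2)\cdots$. A play is an infinite sequence $\pi=\pi_0\pi_1\cdots$ of vertices with $(\pi_j,\pi_{j+1})\in E$ for all $j$; $\mathrm{plays}(\mathcal{A})$ is the set of plays. A strategy for Player $i$ is a function $S:V^*V_i\to V$ with $(v,S(uv))\in E$ for all $u\in V^*$, $v\in V_i$; it is memoryless if $S(uv)=S(u'v)$ for all $u,u'\in V^*$, $v\in V_i$. A play is consistent with a strategy $S$ of Player $i$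 if $\pi_{j+1}=S(\pi_0\cdots\pi_j)$ whenever $\pi_j\in V_i$. A game is a pair $(\mathcal{A},O)$ with $O\subseteq\mathrm{plays}(\mathcal{A})$; a play is won by Player 0 if it is in $O$ and by Player 1 otherwise. A strategy for Player $i$ is winning from $v$ if every play starting at $v$ consistent with it is won by Player $i$. The winning region of Player $i$ is the set of vertices from which Player $i$ has a winning strategy. A cycle is a sequence of edges $(v_1,v_2)(v_2,v_3)\cdots(v_{k-1},v_k)(v_k,v_1)$. The cycles-decomposition $\mathrm{cycles}(\pi)$ of a play $\pi$ is the sequence of cycles output by the following procedure: start with an empty stack; at step $j=0,1,2,\dots$ push the edge $(\pi_j,\pi_{j+1})$, and if for some $k$ the top $k$ edges of the stack form a cycle, pop this cycle and output it. The first cycle of $\pi$ is the first cycle in $\mathrm{cycles}(\pi)$. A cycle property is a set $Y\subseteq\mathbb{U}^*$, and $\neg Y:=\mathbb{U}^*\setminus Y$. $O_{\mathrm{FC}(Y)}(\mathcal{A})$ is the set of plays $\pi$ such that $\lambda(u)\in Y$, where $u$ is the first cycle of $\pi$. $O_{\mathrm{AC}(Y)}(\mathcal{A})$ is the set of plays $\pi$ such that $\lambda(u)\in Y$ for every cycle $u$ in $\mathrm{cycles}(\pi)$. A game $(\mathcal{A},O)$ is $Y$-greedy if $O_{\mathrm{AC}(Y)}(\mathcal{A})\subseteq O$ and $O_{\mathrm{AC}(\neg Y)}(\mathcal{A})\cap O=\emptyset$. *)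

theory Defs
  imports Main
begin

datatype player = Player0 | Player1

record ('v, 'u) arena =
  verts0 :: "'v set"
  verts1 :: "'v set"
  edges :: "('v \<times> 'v) set"
  labels :: "'u set"
  label :: "'v \<times> 'v \<Rightarrow> 'u"

definition verts :: "('v, 'u) arena \<Rightarrow> 'v set" where
  "verts A = verts0 A \<union> verts1 A"

primrec verts_of :: "('v, 'u) arena \<Rightarrow> player \<Rightarrow> 'v set" where
  "verts_of A Player0 = verts0 A"
| "verts_of A Player1 = verts1 A"

definition is_arena :: "('v, 'u) arena \<Rightarrow> bool" where
  "is_arena A \<longleftrightarrow>
     finite (verts0 A) \<and> finite (verts1 A) \<and> verts0 A \<inter> verts1 A = {} \<and> verts A \<noteq> {} \<and>
     edges A \<subseteq> verts A \<times> verts A \<and>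
     (\<forall>v\<in>verts A. \<exists>w. (v, w) \<in> edges A) \<and>
     label A ` edges A \<subseteq> labels A"

definition plays :: "('v, 'u) arena \<Rightarrow> (nat \<Rightarrow> 'v) set" where
  "plays A = {\<pi>. \<forall>j. (\<pi> j, \<pi> (Suc j)) \<in> edges A}"

text \<open>A strategy is a total function on histories whose last entry is the current vertex. Only its
  values on histories over \<open>verts A\<close> that end in a vertex of the player are constrained or used.\<close>

definition is_strategy :: "('v, 'u) arena \<Rightarrow> player \<Rightarrow> ('v list \<Rightarrow> 'v) \<Rightarrow> bool" where
  "is_strategy A i S \<longleftrightarrow>
     (\<forall>u\<in>lists (verts A). \<forall>v\<in>verts_of A i. (v, S (u @ [v])) \<in> edges A)"

definition memoryless :: "('v, 'u) arena \<Rightarrow> player \<Rightarrow> ('v list \<Rightarrow> 'v) \<Rightarrow> bool" where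
  "memoryless A i S \<longleftrightarrow>
     (\<forall>u\<in>lists (verts A). \<forall>u'\<in>lists (verts A). \<forall>v\<in>verts_of A i. S (u @ [v]) = S (u' @ [v]))"

definition consistent ::
    "('v, 'u) arena \<Rightarrow> player \<Rightarrow> ('v list \<Rightarrow> 'v) \<Rightarrow> (nat \<Rightarrow> 'v) \<Rightarrow> bool" where
  "consistent A i S \<pi> \<longleftrightarrow>
     (\<forall>j. \<pi> j \<in> verts_of A i \<longrightarrow> \<pi> (Suc j) = S (map \<pi> [0..<Suc j]))"

primrec won_by :: "(nat \<Rightarrow> 'v) set \<Rightarrow> player \<Rightarrow> (nat \<Rightarrow> 'v) \<Rightarrow> bool" where
  "won_by Obj Player0 \<pi> \<longleftrightarrow> \<pi> \<in> Obj"
| "won_by Obj Player1 \<pi> \<longleftrightarrow> \<pi> \<notin> Obj"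

definition winning_from ::
    "('v, 'u) arena \<Rightarrow> (nat \<Rightarrow> 'v) set \<Rightarrow> player \<Rightarrow> ('v list \<Rightarrow> 'v) \<Rightarrow> 'v \<Rightarrow> bool" where
  "winning_from A Obj i S v \<longleftrightarrow>
     (\<forall>\<pi>\<in>plays A. \<pi> 0 = v \<and> consistent A i S \<pi> \<longrightarrow> won_by Obj i \<pi>)"

definition winning_region ::
    "('v, 'u) arena \<Rightarrow> (nat \<Rightarrow> 'v) set \<Rightarrow> player \<Rightarrow> 'v set" where
  "winning_region A Obj i = {v \<in> verts A. \<exists>S. is_strategy A i S \<and> winning_from A Obj i S v}"

definition is_cycle :: "('v, 'u) arena \<Rightarrow> ('v \<times> 'v) list \<Rightarrow> bool" where
  "is_cycle A es \<longleftrightarrow>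
     es \<noteq> [] \<and> set es \<subseteq> edges A \<and>
     (\<forall>n<length es. snd (es ! n) = fst (es ! (Suc n mod length es)))"

text \<open>Stacks are lists with the top at the right end, so that the edges of a popped cycle
  appear in the order of the play.\<close>

definition top_edges :: "nat \<Rightarrow> 'e list \<Rightarrow> 'e list" where
  "top_edges k s = drop (length s - k) s"

text \<open>The pair of the stack and the list of cycles output so far, after the first \<open>j\<close> steps.
  The edges on the stack always form a path without repeated vertices, so after a push at most one
  \<open>k\<close> qualifies and \<open>LEAST\<close> merely names it.\<close>

primrec decomposition_state ::
    "('v, 'u) arena \<Rightarrow> (nat \<Rightarrow> 'v) \<Rightarrow> nat \<Rightarrow> ('v \<times> 'v) list \<times> ('v \<times> 'v) list list" where
  "decomposition_state A \<pi> 0 = ([], [])"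
| "decomposition_state A \<pi> (Suc j) =
     (let (s, out) = decomposition_state A \<pi> j;
          s' = s @ [(\<pi> j, \<pi> (Suc j))];
          P = (\<lambda>k. k \<le> length s' \<and> is_cycle A (top_edges k s'))
      in if \<exists>k. P k
         then let k = (LEAST k. P k)
              in (take (length s' - k) s', out @ [top_edges k s'])
         else (s', out))"

text \<open>The \<open>n\<close>-th cycle (counting from 0) of the cycles-decomposition; \<open>None\<close> if fewer than \<open>n + 1\<close>
  cycles are ever output. As outputs are only appended, any \<open>j\<close> with enough output gives the same
  cycle.\<close>

definition cycles :: "('v, 'u) arena \<Rightarrow> (nat \<Rightarrow> 'v) \<Rightarrow> nat \<Rightarrow> ('v \<times> 'v) list option" where
  "cycles A \<pi> n =
     (let enough = (\<lambda>j. n < length (snd (decomposition_state A \<pi> j)))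
      in if \<exists>j. enough j
         then Some (snd (decomposition_state A \<pi> (LEAST j. enough j)) ! n)
         else None)"

definition first_cycle_objective ::
    "('v, 'u) arena \<Rightarrow> 'u list set \<Rightarrow> (nat \<Rightarrow> 'v) set" where
  "first_cycle_objective A Y =
     {\<pi> \<in> plays A. \<exists>u. cycles A \<pi> 0 = Some u \<and> map (label A) u \<in> Y}"

definition all_cycles_objective ::
    "('v, 'u) arena \<Rightarrow> 'u list set \<Rightarrow> (nat \<Rightarrow> 'v) set" where
  "all_cycles_objective A Y =
     {\<pi> \<in> plays A. \<forall>n u. cycles A \<pi> n = Some u \<longrightarrow> map (label A) u \<in> Y}"

definition greedy ::
    "('v, 'u) arena \<Rightarrow> 'u list set \<Rightarrow> (nat \<Rightarrow> 'v) set \<Rightarrow> bool" where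
  "greedy A Y Obj \<longleftrightarrow>
     all_cycles_objective A Y \<subseteq> Obj \<and>
     all_cycles_objective A (lists (labels A) - Y) \<inter> Obj = {}"

end

(* A player who moves according to the current stack of the cycles-decomposition, rather than
   according to the history, extends control over the first cycle to control over every cycle of the
   decomposition. The game in which the first cycle decides is a finite game on simple paths, hence
   determined, so exactly one of the players can force all cycles to be good for that player, which
   decides every Y-greedy game from that vertex. The first-cycle objective is itself Y-greedy, and
   thus has the same winning regions as Obj.
   For memoryless strategies, a bad cycle popped during a consistent play can be turned into a lasso:
   walk along the stack and repeat the cycle forever. This play is consistent as well and every cycle
   in its decomposition is the bad one, so a memoryless strategy wins a Y-greedy game iff it never
   allows a bad cycle, a criterion that does not mention the objective. *)

theory Submission
  imports Defs
begin

section \<open>Simple paths as stacks of vertices\<close>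

definition path_edges :: "'v list \<Rightarrow> ('v \<times> 'v) list" where
  "path_edges p = zip p (tl p)"

text \<open>Covers both kinds of step of the decomposition: a fresh \<open>w\<close> leaves
  \<open>p\<close> intact below it, while an old \<open>w\<close> cuts \<open>p\<close> at its
  earlier occurrence, which is the popping of the cycle.\<close>

definition push :: "'v list \<Rightarrow> 'v \<Rightarrow> 'v list" where
  "push p w = takeWhile (\<lambda>x. x \<noteq> w) p @ [w]"

text \<open>The cycle popped when \<open>w\<close> already lies on \<open>p\<close>; for fresh
  \<open>w\<close> the value is the empty list.\<close>

definition closed_cycle :: "'v list \<Rightarrow> 'v \<Rightarrow> ('v \<times> 'v) list" where
  "closed_cycle p w = path_edges (dropWhile (\<lambda>x. x \<noteq> w) p @ [w])"

definition vertex_stack :: "'v list \<Rightarrow> 'v list" where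
  "vertex_stack h = foldl push [] h"

text \<open>The index is chosen to match the edge stack after \<open>j\<close> steps. Unlike the
  edge stack, the vertex stack is never empty, so its last entry always is the current
  vertex.\<close>

definition play_stack :: "(nat \<Rightarrow> 'v) \<Rightarrow> nat \<Rightarrow> 'v list" where
  "play_stack \<pi> j = vertex_stack (map \<pi> [0..<Suc j])"

lemma vertex_stack_snoc [simp]: "vertex_stack (h @ [v]) = push (vertex_stack h) v"
  by (simp add: vertex_stack_def)

lemma play_stack_0 [simp]: "play_stack \<pi> 0 = [\<pi> 0]"
  by (simp add: play_stack_def vertex_stack_def push_def)

lemma play_stack_Suc [simp]: "play_stack \<pi> (Suc j) = push (play_stack \<pi> j) (\<pi> (Suc j))"
  by (simp add: play_stack_def flip: append_assoc vertex_stack_snoc)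

lemma push_not_Nil [simp]: "push p w \<noteq> []"
  and last_push [simp]: "last (push p w) = w"
  by (simp_all add: push_def)

lemma push_fresh: "w \<notin> set p \<Longrightarrow> push p w = p @ [w]"
  by (auto simp: push_def takeWhile_eq_all_conv)

lemma push_old: "w \<notin> set a \<Longrightarrow> push (a @ w # b) w = a @ [w]"
  by (induction a) (auto simp: push_def)

lemma closed_cycle_old: "w \<notin> set a \<Longrightarrow> closed_cycle (a @ w # b) w = path_edges (w # b @ [w])"
  by (induction a) (auto simp: closed_cycle_def)

lemma distinct_push: "distinct p \<Longrightarrow> distinct (push p w)"
  by (auto simp: push_def dest: set_takeWhileD)

lemma set_push: "set (push p w) \<subseteq> insert w (set p)"
  by (auto simp: push_def dest: set_takeWhileD)

lemma hd_push: "p \<noteq> [] \<Longrightarrow> hd (push p w) = hd p"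
  by (cases p) (auto simp: push_def)

lemma successively_push:
  assumes "successively R p" "p \<noteq> []" "R (last p) w"
  shows "successively R (push p w)"
proof (cases "w \<in> set p")
  case True
  then obtain a b where "p = a @ w # b" "w \<notin> set a" by (meson split_list_first)
  then show ?thesis using assms by (auto simp: push_old successively_append_iff)
next
  case False
  then show ?thesis using assms by (auto simp: push_fresh successively_append_iff)
qed

lemma play_stack_not_Nil [simp]: "play_stack \<pi> j \<noteq> []"
  by (cases j) auto

lemma last_play_stack [simp]: "last (play_stack \<pi> j) = \<pi> j"
  by (cases j) auto

lemma distinct_play_stack: "distinct (play_stack \<pi> j)"
  by (induction j) (auto intro: distinct_push)

lemma hd_play_stack: "hd (play_stack \<pi> j) = \<pi> 0"
  by (induction j) (auto simp: hd_push)

text \<open>Popping leaves a prefix, and pushing adds one step of the play. The relation is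
  arbitrary because it will stand both for the edges and for the moves permitted by a memoryless
  strategy.\<close>

lemma successively_play_stack:
  "(\<And>j. R (\<pi> j) (\<pi> (Suc j))) \<Longrightarrow> successively R (play_stack \<pi> j)"
  by (induction j) (auto intro: successively_push)

lemma set_play_stack: "set (play_stack \<pi> j) \<subseteq> range \<pi>"
  using set_push by (induction j) fastforce+

section \<open>The edge stack of the decomposition as the edges of a vertex stack\<close>

lemma length_path_edges [simp]: "length (path_edges p) = length p - 1"
  by (simp add: path_edges_def)

lemma nth_path_edges: "Suc n < length p \<Longrightarrow> path_edges p ! n = (p ! n, p ! Suc n)"
  by (simp add: path_edges_def nth_tl)

lemma path_edges_snoc: "p \<noteq> [] \<Longrightarrow> path_edges (p @ [w]) = path_edges p @ [(last p, w)]"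
  by (induction p rule: rev_induct) (auto simp: path_edges_def nth_append last_conv_nth nth_tl intro!: nth_equalityI)

lemma drop_path_edges: "drop m (path_edges p) = path_edges (drop m p)"
  by (simp add: path_edges_def drop_zip drop_Suc tl_drop)

lemma take_path_edges: "take m (path_edges p) = path_edges (take (Suc m) p)"
  by (rule nth_equalityI) (auto simp: nth_path_edges)

text \<open>Consecutive edges of a path match by construction, so the cyclic condition has content
  only at the wrap-around from the last edge to the first.\<close>

lemma is_cycle_path_edges:
  assumes "successively (\<lambda>x y. (x, y) \<in> edges A) q" "2 \<le> length q"
  shows "is_cycle A (path_edges q) \<longleftrightarrow> hd q = last q"
proof -
  have ne: "path_edges q \<noteq> []" using assms(2) by (auto simp flip: length_0_conv)
  have "set (path_edges q) \<subseteq> edges A"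
  proof
    fix e assume "e \<in> set (path_edges q)"
    then obtain n where "n < length q - 1" "e = path_edges q ! n"
      by (auto simp: in_set_conv_nth)
    then show "e \<in> edges A"
      using assms(1) by (auto simp: nth_path_edges successively_conv_nth)
  qed
  have "is_cycle A (path_edges q) \<longleftrightarrow>
    (\<forall>n<length q - 1. q ! Suc n = q ! (Suc n mod (length q - 1)))"
  proof -
    have "path_edges q ! n = (q ! n, q ! Suc n)" if "n < length q - 1" for n
      using that by (simp add: nth_path_edges)
    moreover have "Suc n mod (length q - 1) < length q - 1" for n
      using assms(2) by (intro mod_less_divisor) simp
    ultimately show ?thesis
      using ne \<open>set (path_edges q) \<subseteq> edges A\<close> by (simp add: is_cycle_def del: One_nat_def)
  qed
  also have "\<dots> \<longleftrightarrow> q ! (length q - 1) = q ! 0"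
  proof
    assume "\<forall>n<length q - 1. q ! Suc n = q ! (Suc n mod (length q - 1))"
    \<comment> \<open>Index \<open>length q - 2\<close> belongs to the last edge, whose successor
      index wraps around to 0.\<close>
    from this[rule_format, of "length q - 2"] show "q ! (length q - 1) = q ! 0"
      using assms(2) by (simp add: numeral_2_eq_2 Suc_diff_Suc)
  next
    assume eq: "q ! (length q - 1) = q ! 0"
    show "\<forall>n<length q - 1. q ! Suc n = q ! (Suc n mod (length q - 1))"
    proof (intro allI impI)
      fix n assume "n < length q - 1"
      then consider "Suc n < length q - 1" | "Suc n = length q - 1" by linarith
      then show "q ! Suc n = q ! (Suc n mod (length q - 1))"
        using eq by cases auto
    qed
  qed
  finally show ?thesis using assms(2)
    by (auto simp: hd_conv_nth last_conv_nth simp flip: length_greater_0_conv)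
qed

text \<open>The top \<open>k\<close> edges start at the vertex with index
  \<open>length p - k\<close> and end in \<open>w\<close>. The value \<open>k = 0\<close> drops out
  because cycles are nonempty.\<close>

lemma is_cycle_top_edges:
  assumes "successively (\<lambda>x y. (x, y) \<in> edges A) (p @ [w])"
  shows "k \<le> length p \<and> is_cycle A (top_edges k (path_edges (p @ [w]))) \<longleftrightarrow>
    0 < k \<and> k \<le> length p \<and> p ! (length p - k) = w"
proof (cases "0 < k \<and> k \<le> length p")
  case True
  let ?q = "drop (length p - k) (p @ [w])"
  have "top_edges k (path_edges (p @ [w])) = path_edges ?q"
    by (simp add: top_edges_def drop_path_edges)
  moreover have "successively (\<lambda>x y. (x, y) \<in> edges A) ?q"
    using assms by (metis append_take_drop_id successively_append_iff)
  moreover have "2 \<le> length ?q" using True by auto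
  moreover have "hd ?q = p ! (length p - k)" "last ?q = w"
    using True by (auto simp: hd_drop_conv_nth hd_append)
  ultimately show ?thesis using True is_cycle_path_edges[of A ?q] by auto
next
  case False
  then show ?thesis by (auto simp: is_cycle_def top_edges_def)
qed

text \<open>Translates one step of the given procedure into \<open>push\<close> and
  \<open>closed_cycle\<close>; everything later argues about vertex stacks only.\<close>

lemma decomposition_state_Suc:
  assumes "fst (decomposition_state A \<pi> j) = path_edges p" "p \<noteq> []" "distinct p" "last p = \<pi> j"
    and "successively (\<lambda>x y. (x, y) \<in> edges A) p" "(\<pi> j, \<pi> (Suc j)) \<in> edges A"
  shows "decomposition_state A \<pi> (Suc j) =
    (path_edges (push p (\<pi> (Suc j))),
     snd (decomposition_state A \<pi> j) @
       (if \<pi> (Suc j) \<in> set p then [closed_cycle p (\<pi> (Suc j))] else []))"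
proof -
  define w where "w = \<pi> (Suc j)"
  obtain out where st: "decomposition_state A \<pi> j = (path_edges p, out)"
    using assms(1) by (metis prod.collapse)
  have s': "path_edges p @ [(\<pi> j, w)] = path_edges (p @ [w])"
    using assms by (simp add: path_edges_snoc)
  have len: "length (path_edges (p @ [w])) = length p" by simp
  have succ: "successively (\<lambda>x y. (x, y) \<in> edges A) (p @ [w])"
    using assms by (auto simp: successively_append_iff w_def)
  note cyc = is_cycle_top_edges[OF succ]
  have state: "decomposition_state A \<pi> (Suc j) =
    (let P = \<lambda>k. k \<le> length p \<and> is_cycle A (top_edges k (path_edges (p @ [w])))
     in if \<exists>k. P k
        then let k = LEAST k. P k
             in (take (length p - k) (path_edges (p @ [w])), out @ [top_edges k (path_edges (p @ [w]))])
        else (path_edges (p @ [w]), out))"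
    by (simp only: decomposition_state.simps st prod.case Let_def s' len flip: w_def)
  show ?thesis
  proof (cases "w \<in> set p")
    case False
    then have "\<not> (0 < k \<and> k \<le> length p \<and> p ! (length p - k) = w)" for k
      by (metis diff_less length_greater_0_conv nth_mem assms(2))
    with False show ?thesis
      unfolding state cyc by (auto simp: Let_def st push_fresh simp flip: w_def)
  next
    case True
    then obtain a b where p: "p = a @ w # b" and a: "w \<notin> set a" by (meson split_list_first)
    have b: "w \<notin> set b" using assms(3) p by auto
    \<comment> \<open>By distinctness \<open>w\<close> occurs in \<open>p\<close> only at index
      \<open>length a\<close>; the cycle from there has \<open>Suc (length b)\<close> edges, the
      closing one included. Hence \<open>LEAST\<close> ranges over a single value.\<close>
    have "0 < k \<and> k \<le> length p \<and> p ! (length p - k) = w \<longleftrightarrow> k = Suc (length b)" (is "?L k \<longleftrightarrow> _") for k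
    proof
      assume L: "?L k"
      then have "p ! (length p - k) = p ! length a" "length p - k < length p" "length a < length p"
        using p by auto
      then have "length p - k = length a" using assms(3) by (simp add: nth_eq_iff_index_eq)
      then show "k = Suc (length b)" using L p by auto
    next
      assume "k = Suc (length b)"
      then show "?L k" using p by auto
    qed
    note cyc' = cyc[unfolded this]
    have top: "top_edges (Suc (length b)) (path_edges (p @ [w])) = closed_cycle p w"
      using a by (simp add: top_edges_def drop_path_edges p closed_cycle_old)
    have tk: "take (length p - Suc (length b)) (path_edges (p @ [w])) = path_edges (push p w)"
      using a by (simp add: take_path_edges p push_old)
    have least: "(LEAST k. k = Suc (length b)) = Suc (length b)"
      by (rule Least_equality) auto
    show ?thesis using True
      unfolding state cyc' by (simp add: Let_def least st top tk flip: w_def)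
  qed
qed

lemma decomposition_state_stack:
  assumes "\<pi> \<in> plays A"
  shows "fst (decomposition_state A \<pi> j) = path_edges (play_stack \<pi> j)"
proof (induction j)
  case 0
  show ?case by (simp add: path_edges_def)
next
  case (Suc j)
  have "(\<pi> j, \<pi> (Suc j)) \<in> edges A" for j using assms by (simp add: plays_def)
  then show ?case
    using decomposition_state_Suc[OF Suc.IH _ distinct_play_stack] successively_play_stack[of _ \<pi> j]
    by simp
qed

lemma decomposition_output_Suc:
  assumes "\<pi> \<in> plays A"
  shows "snd (decomposition_state A \<pi> (Suc j)) = snd (decomposition_state A \<pi> j) @
    (if \<pi> (Suc j) \<in> set (play_stack \<pi> j) then [closed_cycle (play_stack \<pi> j) (\<pi> (Suc j))] else [])"
proof -
  have "(\<pi> j, \<pi> (Suc j)) \<in> edges A" for j using assms by (simp add: plays_def)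
  then show ?thesis
    using decomposition_state_Suc[OF decomposition_state_stack[OF assms] _ distinct_play_stack]
      successively_play_stack[of _ \<pi> j]
    by simp
qed

section \<open>Cycles of a play, read off its vertex stacks\<close>

text \<open>Speaks about the steps that close a cycle instead of the outputs of
  \<open>cycles\<close>, so that invariants of the stack apply to it directly.\<close>

definition closings_satisfy :: "(('v \<times> 'v) list \<Rightarrow> bool) \<Rightarrow> (nat \<Rightarrow> 'v) \<Rightarrow> bool" where
  "closings_satisfy G \<pi> \<longleftrightarrow>
     (\<forall>j. \<pi> (Suc j) \<in> set (play_stack \<pi> j) \<longrightarrow> G (closed_cycle (play_stack \<pi> j) (\<pi> (Suc j))))"

lemma closings_satisfy_cycles:
  assumes "\<pi> \<in> plays A" "closings_satisfy G \<pi>" "cycles A \<pi> n = Some u"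
  shows "G u"
proof -
  have out: "\<forall>u\<in>set (snd (decomposition_state A \<pi> j)). G u" for j
  proof (induction j)
    case (Suc j)
    then show ?case using assms(2)
      unfolding decomposition_output_Suc[OF assms(1)] closings_satisfy_def by auto
  qed simp
  let ?enough = "\<lambda>j. n < length (snd (decomposition_state A \<pi> j))"
  have ex: "\<exists>j. ?enough j" and u: "u = snd (decomposition_state A \<pi> (LEAST j. ?enough j)) ! n"
    using assms(3) by (auto simp: cycles_def Let_def split: if_splits)
  have "?enough (LEAST j. ?enough j)" using ex by (rule LeastI_ex)
  then show ?thesis unfolding u using out nth_mem by blast
qed

lemma finite_verts: "is_arena A \<Longrightarrow> finite (verts A)"
  by (auto simp: is_arena_def verts_def)

lemma edge_verts: "is_arena A \<Longrightarrow> (x, y) \<in> edges A \<Longrightarrow> x \<in> verts A \<and> y \<in> verts A"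
  by (auto simp: is_arena_def)

lemma play_verts: "is_arena A \<Longrightarrow> \<pi> \<in> plays A \<Longrightarrow> \<pi> j \<in> verts A"
  by (auto simp: plays_def dest: edge_verts)

text \<open>Pigeonhole: without any output nothing is ever popped, so the stack grows at each step,
  yet its vertices are distinct and come from a finite set.\<close>

lemma first_cycle_exists:
  assumes "is_arena A" "\<pi> \<in> plays A"
  shows "\<exists>u. cycles A \<pi> 0 = Some u"
proof (rule ccontr)
  assume "\<not> ?thesis"
  then have empty: "snd (decomposition_state A \<pi> j) = []" for j
    by (auto simp: cycles_def Let_def split: if_splits)
  have fresh: "\<pi> (Suc j) \<notin> set (play_stack \<pi> j)" for j
    using decomposition_output_Suc[OF assms(2), of j] empty by (auto split: if_splits simp del: decomposition_state.simps)
  have len: "length (play_stack \<pi> j) = Suc j" for j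
    by (induction j) (auto simp: push_fresh fresh)
  have "length (play_stack \<pi> j) \<le> card (verts A)" for j
    using set_play_stack[of \<pi> j] play_verts[OF assms] finite_verts[OF assms(1)]
    by (metis card_mono distinct_card distinct_play_stack image_subset_iff subset_trans top_greatest)
  from this[of "card (verts A)"] show False by (simp add: len)
qed

text \<open>Complements of cycle properties are taken within \<open>lists (labels A)\<close>; this
  supplies the membership that Player 1 needs.\<close>

lemma cycles_labels:
  assumes "is_arena A" "\<pi> \<in> plays A" "cycles A \<pi> n = Some u"
  shows "map (label A) u \<in> lists (labels A)"
proof -
  have "set (closed_cycle (play_stack \<pi> j) (\<pi> (Suc j))) \<subseteq> edges A" for j
  proof -
    \<comment> \<open>A suffix of the stack extended by the next vertex, hence a path of the
      arena.\<close>
    let ?q = "dropWhile (\<lambda>x. x \<noteq> \<pi> (Suc j)) (play_stack \<pi> j) @ [\<pi> (Suc j)]"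
    have e: "(\<pi> j, \<pi> (Suc j)) \<in> edges A" for j using assms(2) by (simp add: plays_def)
    then have "successively (\<lambda>x y. (x, y) \<in> edges A) (play_stack \<pi> j @ [\<pi> (Suc j)])"
      by (simp add: successively_append_iff successively_play_stack)
    then have "successively (\<lambda>x y. (x, y) \<in> edges A)
      (takeWhile (\<lambda>x. x \<noteq> \<pi> (Suc j)) (play_stack \<pi> j) @ ?q)"
      unfolding append_assoc[symmetric] takeWhile_dropWhile_id .
    then have "successively (\<lambda>x y. (x, y) \<in> edges A) ?q"
      unfolding successively_append_iff by blast
    then show ?thesis
      by (auto simp: closed_cycle_def in_set_conv_nth nth_path_edges successively_conv_nth
          simp del: length_append)
  qed
  then have "closings_satisfy (\<lambda>u. set u \<subseteq> edges A) \<pi>" by (simp add: closings_satisfy_def)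
  from closings_satisfy_cycles[OF assms(2) this assms(3)] have "set u \<subseteq> edges A" .
  moreover have "label A ` edges A \<subseteq> labels A" using assms(1) by (simp add: is_arena_def)
  ultimately show ?thesis by (auto simp: image_subset_iff subset_iff)
qed

section \<open>Good cycles and greedy objectives\<close>

primrec opponent :: "player \<Rightarrow> player" where
  "opponent Player0 = Player1"
| "opponent Player1 = Player0"

primrec good_cycle :: "('v, 'u) arena \<Rightarrow> 'u list set \<Rightarrow> player \<Rightarrow> ('v \<times> 'v) list \<Rightarrow> bool" where
  "good_cycle A Y Player0 u \<longleftrightarrow> map (label A) u \<in> Y"
| "good_cycle A Y Player1 u \<longleftrightarrow> map (label A) u \<notin> Y"

lemma good_cycle_opponent: "good_cycle A Y (opponent i) u \<longleftrightarrow> \<not> good_cycle A Y i u"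
  by (cases i) auto

lemma won_by_opponent: "won_by Obj (opponent i) \<pi> \<longleftrightarrow> \<not> won_by Obj i \<pi>"
  by (cases i) auto

text \<open>Joins the two halves of greediness into one statement for both players; later proofs use
  greediness only through it.\<close>

lemma greedy_won:
  assumes "is_arena A" "greedy A Y Obj" "\<pi> \<in> plays A" "closings_satisfy (good_cycle A Y i) \<pi>"
  shows "won_by Obj i \<pi>"
proof (cases i)
  case Player0
  then have "\<pi> \<in> all_cycles_objective A Y"
    using assms(3,4) closings_satisfy_cycles by (fastforce simp: all_cycles_objective_def)
  then show ?thesis using assms(2) Player0 by (auto simp: greedy_def)
next
  case Player1
  then have "\<pi> \<in> all_cycles_objective A (lists (labels A) - Y)"
    using assms closings_satisfy_cycles[OF assms(3,4)] cycles_labels[OF assms(1,3)]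
    by (fastforce simp: all_cycles_objective_def)
  then show ?thesis using assms(2) Player1 by (auto simp: greedy_def)
qed

text \<open>Since a first cycle always exists, its label decides as all labels do whenever these
  agree on \<open>Y\<close>. Thus every result on greedy games also applies to the first-cycle
  game.\<close>

lemma greedy_first_cycle:
  assumes "is_arena A"
  shows "greedy A Y (first_cycle_objective A Y)"
  using first_cycle_exists[OF assms]
  by (fastforce simp: greedy_def all_cycles_objective_def first_cycle_objective_def)

lemma arena_successor: "is_arena A \<Longrightarrow> v \<in> verts A \<Longrightarrow> \<exists>w. (v, w) \<in> edges A"
  by (auto simp: is_arena_def)

lemma verts_of_subset: "v \<in> verts_of A i \<Longrightarrow> v \<in> verts A"
  by (cases i) (auto simp: verts_def)

lemma verts_of_opponent:
  "is_arena A \<Longrightarrow> v \<in> verts A \<Longrightarrow> v \<in> verts_of A (opponent i) \<longleftrightarrow> v \<notin> verts_of A i"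
  by (cases i) (auto simp: is_arena_def verts_def)

section \<open>Plays generated from histories, and the conflict of two winning strategies\<close>

lemma ex_play_from_history:
  fixes g :: "'v list \<Rightarrow> 'v"
  shows "\<exists>\<pi>. \<pi> 0 = v \<and> (\<forall>j. \<pi> (Suc j) = g (map \<pi> [0..<Suc j]))"
proof -
  \<comment> \<open>The next vertex depends on the whole past, so the recursion runs over histories
    and the play is read off their last entries.\<close>
  define h where "h = rec_nat [v] (\<lambda>_ h. h @ [g h])"
  have h: "h 0 = [v]" "\<And>j. h (Suc j) = h j @ [g (h j)]" by (simp_all add: h_def)
  define \<pi> where "\<pi> j = last (h j)" for j
  have eq: "map \<pi> [0..<Suc j] = h j" for j
    by (induction j) (simp_all add: \<pi>_def h)
  show ?thesis
  proof (intro exI conjI allI)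
    show "\<pi> 0 = v" by (simp add: \<pi>_def h)
    show "\<pi> (Suc j) = g (map \<pi> [0..<Suc j])" for j
      unfolding eq by (simp add: \<pi>_def h)
  qed
qed

lemma history_lists:
  assumes "\<And>k. k < j \<Longrightarrow> \<pi> k \<in> verts A"
  shows "map \<pi> [0..<j] \<in> lists (verts A)"
  using assms by auto

text \<open>Playing both strategies against each other yields a play consistent with both, which
  would be won by both players.\<close>

lemma not_both_winning:
  assumes "is_arena A" "v \<in> verts A"
    and "is_strategy A i S" "winning_from A Obj i S v"
    and "is_strategy A (opponent i) T" "winning_from A Obj (opponent i) T v"
  shows False
proof -
  define g where "g h = (if last h \<in> verts_of A i then S h else T h)" for h
  obtain \<pi> where \<pi>: "\<pi> 0 = v" "\<And>j. \<pi> (Suc j) = g (map \<pi> [0..<Suc j])"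
    using ex_play_from_history by metis
  have next_eq: "\<pi> (Suc j) = (if \<pi> j \<in> verts_of A i then S (map \<pi> [0..<j] @ [\<pi> j])
      else T (map \<pi> [0..<j] @ [\<pi> j]))" for j
    using \<pi>(2)[of j] by (simp add: g_def)
  have verts: "\<forall>k\<le>j. \<pi> k \<in> verts A" and edge: "(\<pi> j, \<pi> (Suc j)) \<in> edges A" for j
  proof -
    \<comment> \<open>Strategies are known to be legal only on histories over
      \<open>verts A\<close>, so each edge needs all earlier vertices to lie in the arena, and in
      turn provides the next one.\<close>
    have step: "(\<pi> j, \<pi> (Suc j)) \<in> edges A" if "\<forall>k\<le>j. \<pi> k \<in> verts A" for j
    proof -
      have "map \<pi> [0..<j] \<in> lists (verts A)" using that by (intro history_lists) auto
      then show ?thesis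
        using next_eq[of j] assms(3,5) verts_of_opponent[OF assms(1), of "\<pi> j" i] that
        by (auto simp: is_strategy_def)
    qed
    show *: "\<forall>k\<le>j. \<pi> k \<in> verts A" for j
    proof (induction j)
      case 0
      then show ?case using \<pi>(1) assms(2) by simp
    next
      case (Suc j)
      then show ?case using step[OF Suc] edge_verts[OF assms(1)] by (auto simp: le_Suc_eq)
    qed
    show "(\<pi> j, \<pi> (Suc j)) \<in> edges A" using step * by blast
  qed
  then have play: "\<pi> \<in> plays A" by (simp add: plays_def)
  have "\<pi> j \<in> verts_of A (opponent i) \<longleftrightarrow> \<pi> j \<notin> verts_of A i" for j
    using verts[of j] by (intro verts_of_opponent[OF assms(1)]) simp
  then have "consistent A i S \<pi>" "consistent A (opponent i) T \<pi>"
    using next_eq by (auto simp: consistent_def)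
  then show False
    using assms(4,6) play \<pi>(1) by (auto simp: winning_from_def won_by_opponent)
qed

section \<open>The finite game on simple paths and its determinacy\<close>

text \<open>A set \<open>W\<close> of simple paths plays the role of a winning region in the finite game that ends
  with the first cycle: the player can keep the path in \<open>W\<close> until a cycle satisfying \<open>G\<close> closes.\<close>

definition admissible ::
    "(('v \<times> 'v) list \<Rightarrow> bool) \<Rightarrow> 'v list set \<Rightarrow> 'v list \<Rightarrow> 'v \<Rightarrow> bool" where
  "admissible G W p w \<longleftrightarrow> (if w \<in> set p then G (closed_cycle p w) else p @ [w] \<in> W)"

definition safe_paths ::
    "('v, 'u) arena \<Rightarrow> player \<Rightarrow> (('v \<times> 'v) list \<Rightarrow> bool) \<Rightarrow> 'v list set \<Rightarrow> bool" where
  "safe_paths A i G W \<longleftrightarrow>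
     (\<forall>p\<in>W. if last p \<in> verts_of A i
             then \<exists>w. (last p, w) \<in> edges A \<and> admissible G W p w
             else \<forall>w. (last p, w) \<in> edges A \<longrightarrow> admissible G W p w)"

text \<open>The player moves according to the current vertex stack instead of the history. Popping a
  cycle turns the stack into one of its own prefixes, so the invariant is that all nonempty
  prefixes of the stack are safe.\<close>

lemma safe_paths_strategy:
  assumes "is_arena A" "safe_paths A i G W"
  obtains S where "is_strategy A i S"
    "\<And>\<pi>. \<pi> \<in> plays A \<Longrightarrow> [\<pi> 0] \<in> W \<Longrightarrow> consistent A i S \<pi> \<Longrightarrow> closings_satisfy G \<pi>"
proof -
  \<comment> \<open>Where no admissible move exists, an arbitrary successor keeps the strategy legal
    on stacks outside \<open>W\<close>.\<close>
  define f where "f p = (if \<exists>w. (last p, w) \<in> edges A \<and> admissible G W p w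
    then SOME w. (last p, w) \<in> edges A \<and> admissible G W p w
    else SOME w. (last p, w) \<in> edges A)" for p
  have f_edge: "(last p, f p) \<in> edges A" if "last p \<in> verts A" for p
  proof (cases "\<exists>w. (last p, w) \<in> edges A \<and> admissible G W p w")
    case True
    then show ?thesis using someI_ex[OF True] by (simp only: f_def if_True simp_thms)
  next
    case False
    then show ?thesis using someI_ex[OF arena_successor[OF assms(1) that]] by (simp only: f_def if_False)
  qed
  have f_adm: "admissible G W p (f p)" if "p \<in> W" "last p \<in> verts_of A i" for p
  proof -
    have ex: "\<exists>w. (last p, w) \<in> edges A \<and> admissible G W p w"
      using assms(2) that by (auto simp: safe_paths_def)
    then show ?thesis using someI_ex[OF ex] by (simp add: f_def)
  qed
  show thesis
  proof (rule that)
    show "is_strategy A i (\<lambda>h. f (vertex_stack h))"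
      unfolding is_strategy_def
    proof (intro ballI)
      fix u v assume "v \<in> verts_of A i"
      then show "(v, f (vertex_stack (u @ [v]))) \<in> edges A"
        using f_edge[of "vertex_stack (u @ [v])"] by (simp add: verts_of_subset)
    qed
    fix \<pi> assume play: "\<pi> \<in> plays A" and start: "[\<pi> 0] \<in> W"
      and cons: "consistent A i (\<lambda>h. f (vertex_stack h)) \<pi>"
    have adm: "admissible G W (play_stack \<pi> j) (\<pi> (Suc j))" if "play_stack \<pi> j \<in> W" for j
    proof (cases "\<pi> j \<in> verts_of A i")
      case True
      then have "\<pi> (Suc j) = f (play_stack \<pi> j)"
        using cons by (simp add: consistent_def play_stack_def)
      then show ?thesis using f_adm[OF that] True by simp
    next
      case False
      then show ?thesis using assms(2) that play by (force simp: safe_paths_def plays_def)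
    qed
    have inv: "\<forall>a b. play_stack \<pi> j = a @ b \<and> a \<noteq> [] \<longrightarrow> a \<in> W" for j
    proof (induction j)
      case 0
      then show ?case using start by (auto simp: Cons_eq_append_conv)
    next
      case (Suc j)
      let ?p = "play_stack \<pi> j" and ?w = "\<pi> (Suc j)"
      show ?case
      proof (cases "?w \<in> set ?p")
        case True
        then obtain a b where p: "?p = a @ ?w # b" and a: "?w \<notin> set a" by (meson split_list_first)
        have "?p = play_stack \<pi> (Suc j) @ b" using a by (simp add: p push_old)
        then show ?thesis using Suc by (metis append.assoc)
      next
        case False
        have "?p @ [?w] \<in> W" using adm[of j] Suc False by (auto simp: admissible_def)
        then show ?thesis using Suc False
          by (auto simp: push_fresh append_eq_append_conv2 append_eq_Cons_conv Cons_eq_append_conv)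
      qed
    qed
    show "closings_satisfy G \<pi>"
      unfolding closings_satisfy_def
    proof (intro allI impI)
      fix j assume "\<pi> (Suc j) \<in> set (play_stack \<pi> j)"
      moreover have "play_stack \<pi> j \<in> W" using inv[of j] by simp
      ultimately show "G (closed_cycle (play_stack \<pi> j) (\<pi> (Suc j)))"
        using adm[of j] by (simp add: admissible_def)
    qed
  qed
qed

text \<open>The disjunctions below spell out \<open>admissible\<close>. The complement of the least fixed point is
  safe for the opponent, which is the determinacy of the finite game.\<close>

inductive_set forced_paths :: "('v, 'u) arena \<Rightarrow> player \<Rightarrow> (('v \<times> 'v) list \<Rightarrow> bool) \<Rightarrow> 'v list set"
  for A i G where
  own: "last p \<in> verts_of A i \<Longrightarrow> (last p, w) \<in> edges A \<Longrightarrow>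
    (w \<in> set p \<and> G (closed_cycle p w)) \<or> (w \<notin> set p \<and> p @ [w] \<in> forced_paths A i G) \<Longrightarrow>
    p \<in> forced_paths A i G"
| other: "last p \<notin> verts_of A i \<Longrightarrow>
    (\<And>w. (last p, w) \<in> edges A \<Longrightarrow>
      (w \<in> set p \<and> G (closed_cycle p w)) \<or> (w \<notin> set p \<and> p @ [w] \<in> forced_paths A i G)) \<Longrightarrow>
    p \<in> forced_paths A i G"

lemma safe_forced_paths: "safe_paths A i G (forced_paths A i G)"
  unfolding safe_paths_def
proof
  fix p assume "p \<in> forced_paths A i G"
  then show "if last p \<in> verts_of A i
    then \<exists>w. (last p, w) \<in> edges A \<and> admissible G (forced_paths A i G) p w
    else \<forall>w. (last p, w) \<in> edges A \<longrightarrow> admissible G (forced_paths A i G) p w"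
    by cases (auto simp: admissible_def)
qed

text \<open>Contrapositive of the introduction rules: from an unforced path the player has no move
  to a good cycle or to a forced path, and the opponent has a move that avoids both.\<close>

lemma safe_unforced_paths:
  assumes "is_arena A"
  shows "safe_paths A (opponent i) (\<lambda>u. \<not> G u) (- forced_paths A i G)"
  unfolding safe_paths_def
proof
  fix p assume p: "p \<in> - forced_paths A i G"
  show "if last p \<in> verts_of A (opponent i)
    then \<exists>w. (last p, w) \<in> edges A \<and> admissible (\<lambda>u. \<not> G u) (- forced_paths A i G) p w
    else \<forall>w. (last p, w) \<in> edges A \<longrightarrow> admissible (\<lambda>u. \<not> G u) (- forced_paths A i G) p w"
  proof (cases "last p \<in> verts_of A (opponent i)")
    case True
    then have "last p \<notin> verts_of A i"
      using verts_of_opponent[OF assms] verts_of_subset by metis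
    then show ?thesis using p True forced_paths.other[of p A i G]
      by (auto simp: admissible_def)
  next
    case False
    have "admissible (\<lambda>u. \<not> G u) (- forced_paths A i G) p w" if "(last p, w) \<in> edges A" for w
    proof -
      \<comment> \<open>The complement contains arbitrary lists; it is the edge that puts
        \<open>last p\<close> into the arena and so gives it an owner.\<close>
      have "last p \<in> verts_of A i"
        using False that verts_of_opponent[OF assms] edge_verts[OF assms] by blast
      then show ?thesis using p that forced_paths.own[of p A i w G]
        by (auto simp: admissible_def)
    qed
    then show ?thesis using False by simp
  qed
qed

text \<open>The right-hand side does not mention \<open>Obj\<close>, so greedy games for the same
  \<open>Y\<close> share their winning regions. From an unforced vertex the opponent wins, which
  excludes a winning strategy of the player.\<close>

lemma greedy_winning_region:
  assumes "is_arena A" "greedy A Y Obj"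
  shows "winning_region A Obj i = {v \<in> verts A. [v] \<in> forced_paths A i (good_cycle A Y i)}"
proof -
  let ?W = "forced_paths A i (good_cycle A Y i)"
  have opp: "(\<lambda>u. \<not> good_cycle A Y i u) = good_cycle A Y (opponent i)"
    by (simp add: good_cycle_opponent fun_eq_iff)
  have "\<exists>S. is_strategy A i S \<and> winning_from A Obj i S v" if "[v] \<in> ?W" for v
    using safe_paths_strategy[OF assms(1) safe_forced_paths] greedy_won[OF assms] that
    unfolding winning_from_def by metis
  moreover have "\<exists>T. is_strategy A (opponent i) T \<and> winning_from A Obj (opponent i) T v"
    if "[v] \<notin> ?W" for v
  proof -
    from safe_paths_strategy[OF assms(1) safe_unforced_paths[OF assms(1)]]
    obtain T where "is_strategy A (opponent i) T"
      "\<And>\<pi>. \<pi> \<in> plays A \<Longrightarrow> [\<pi> 0] \<in> - ?W \<Longrightarrow> consistent A (opponent i) T \<pi> \<Longrightarrow>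
        closings_satisfy (good_cycle A Y (opponent i)) \<pi>"
      unfolding opp[symmetric] by blast
    then show ?thesis
      using greedy_won[OF assms] that unfolding winning_from_def by (metis ComplI)
  qed
  ultimately show ?thesis
    using not_both_winning[OF assms(1)] unfolding winning_region_def by blast
qed

section \<open>Lassos and memoryless strategies\<close>

text \<open>The play climbs along \<open>p\<close>, takes the closing step to \<open>w\<close>,
  falls back to the prefix of \<open>p\<close> ending in \<open>w\<close>, and climbs again. Its
  stack is always a prefix of \<open>p\<close>, which leaves only one cycle to close.\<close>

lemma lasso:
  fixes p :: "'v list"
  assumes "distinct p" "p \<noteq> []" "w \<in> set p" "successively R (p @ [w])"
  obtains \<sigma> where "\<sigma> 0 = hd p" "\<And>j. R (\<sigma> j) (\<sigma> (Suc j))"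
    "closings_satisfy (\<lambda>u. u = closed_cycle p w) \<sigma>"
proof -
  \<comment> \<open>The length of the stack is the index of the next vertex; at full length it
    reaches the appended \<open>w\<close>, the closing step.\<close>
  define g :: "'v list \<Rightarrow> 'v" where "g h = (p @ [w]) ! length (vertex_stack h)" for h
  obtain \<sigma> where \<sigma>: "\<sigma> 0 = hd p" "\<And>j. \<sigma> (Suc j) = g (map \<sigma> [0..<Suc j])"
    using ex_play_from_history by metis
  have nxt: "\<sigma> (Suc j) = (p @ [w]) ! length (play_stack \<sigma> j)" for j
    using \<sigma>(2)[of j] by (simp only: g_def play_stack_def)
  have fresh: "p ! k \<notin> set (take k p)" if "k < length p" for k
    using assms(1) that by (auto simp: in_set_conv_nth nth_eq_iff_index_eq)
  obtain a b where p: "p = a @ w # b" and a: "w \<notin> set a"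
    using assms(3) by (meson split_list_first)
  have inv: "\<exists>k. 0 < k \<and> k \<le> length p \<and> play_stack \<sigma> j = take k p" for j
  proof (induction j)
    case 0
    show ?case using assms(2) \<sigma>(1) by (intro exI[of _ 1]) (cases p; auto)
  next
    case (Suc j)
    then obtain k where k: "0 < k" "k \<le> length p" "play_stack \<sigma> j = take k p" by blast
    show ?case
    proof (cases "k < length p")
      case True
      then have "play_stack \<sigma> (Suc j) = take (Suc k) p"
        using k fresh nxt[of j] by (simp add: push_fresh nth_append take_Suc_conv_app_nth)
      then show ?thesis using True by (intro exI[of _ "Suc k"]) auto
    next
      case False
      then have "play_stack \<sigma> j = p" "\<sigma> (Suc j) = w" using k nxt[of j] by auto
      then have "play_stack \<sigma> (Suc j) = a @ [w]" using a by (simp add: p push_old)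
      then show ?thesis by (intro exI[of _ "Suc (length a)"]) (simp add: p)
    qed
  qed
  show thesis
  proof (rule that)
    show "\<sigma> 0 = hd p" by (rule \<sigma>)
    show "R (\<sigma> j) (\<sigma> (Suc j))" for j
    proof -
      obtain k where k: "0 < k" "k \<le> length p" "play_stack \<sigma> j = take k p" using inv by blast
      have "\<sigma> j = last (take k p)" using k(3) last_play_stack[of \<sigma> j] by simp
      also have "\<dots> = (p @ [w]) ! (k - 1)"
        using k assms(2) by (auto simp: last_conv_nth nth_append min_def)
      finally have "\<sigma> j = (p @ [w]) ! (k - 1)" .
      moreover have "\<sigma> (Suc j) = (p @ [w]) ! Suc (k - 1)" using k nxt[of j] by simp
      ultimately show ?thesis using assms(4) k
        unfolding successively_conv_nth by (metis Suc_pred' length_append_singleton less_Suc_eq_le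
            Suc_less_eq diff_Suc_1')
    qed
    show "closings_satisfy (\<lambda>u. u = closed_cycle p w) \<sigma>"
      unfolding closings_satisfy_def
    proof (intro allI impI)
      fix j assume old: "\<sigma> (Suc j) \<in> set (play_stack \<sigma> j)"
      obtain k where k: "0 < k" "k \<le> length p" "play_stack \<sigma> j = take k p" using inv by blast
      \<comment> \<open>On a proper prefix the next vertex \<open>p ! k\<close> is fresh by
        distinctness, so cycles close only at full length.\<close>
      have "k = length p"
        using old k fresh[of k] nxt[of j] by (cases "k < length p") (auto simp: nth_append)
      then show "closed_cycle (play_stack \<sigma> j) (\<sigma> (Suc j)) = closed_cycle p w"
        using k nxt[of j] by simp
    qed
  qed
qed

text \<open>Turns consistency into a condition on consecutive vertices, with the empty past
  representing all pasts.\<close>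

lemma consistent_memoryless:
  assumes "is_arena A" "memoryless A i S" "\<pi> \<in> plays A"
  shows "consistent A i S \<pi> \<longleftrightarrow> (\<forall>j. \<pi> j \<in> verts_of A i \<longrightarrow> \<pi> (Suc j) = S [\<pi> j])"
proof -
  have "S (map \<pi> [0..<Suc j]) = S [\<pi> j]" if "\<pi> j \<in> verts_of A i" for j
  proof -
    have "map \<pi> [0..<j] \<in> lists (verts A)"
      using play_verts[OF assms(1,3)] by (intro history_lists)
    then have "S (map \<pi> [0..<j] @ [\<pi> j]) = S ([] @ [\<pi> j])"
      using assms(2) that unfolding memoryless_def by blast
    then show ?thesis by simp
  qed
  then show ?thesis by (auto simp: consistent_def simp del: upt_Suc)
qed

lemma greedy_memoryless_winning:
  assumes "is_arena A" "greedy A Y Obj" "memoryless A i S"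
  shows "winning_from A Obj i S v \<longleftrightarrow>
    (\<forall>\<pi>\<in>plays A. \<pi> 0 = v \<and> consistent A i S \<pi> \<longrightarrow> closings_satisfy (good_cycle A Y i) \<pi>)"
proof
  assume win: "winning_from A Obj i S v"
  show "\<forall>\<pi>\<in>plays A. \<pi> 0 = v \<and> consistent A i S \<pi> \<longrightarrow> closings_satisfy (good_cycle A Y i) \<pi>"
  proof (intro ballI impI, elim conjE)
    fix \<pi> assume play: "\<pi> \<in> plays A" and v: "\<pi> 0 = v" and cons: "consistent A i S \<pi>"
    \<comment> \<open>The moves that the strategy permits. As a relation between consecutive
      vertices, \<open>R\<close> carries over from the stack of \<open>\<pi>\<close> to the lasso
      and makes the lasso consistent.\<close>
    define R where "R x y \<longleftrightarrow> (x, y) \<in> edges A \<and> (x \<in> verts_of A i \<longrightarrow> y = S [x])" for x y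
    have R: "R (\<pi> j) (\<pi> (Suc j))" for j
      using play cons consistent_memoryless[OF assms(1,3) play] by (simp add: R_def plays_def)
    show "closings_satisfy (good_cycle A Y i) \<pi>"
      unfolding closings_satisfy_def
    proof (intro allI impI, rule ccontr)
      fix j
      let ?u = "closed_cycle (play_stack \<pi> j) (\<pi> (Suc j))"
      assume old: "\<pi> (Suc j) \<in> set (play_stack \<pi> j)" and bad: "\<not> good_cycle A Y i ?u"
      have "successively R (play_stack \<pi> j @ [\<pi> (Suc j)])"
        using R by (simp add: successively_append_iff successively_play_stack)
      from lasso[OF distinct_play_stack play_stack_not_Nil old this]
      obtain \<sigma> where \<sigma>: "\<sigma> 0 = v" "\<And>j. R (\<sigma> j) (\<sigma> (Suc j))" "closings_satisfy (\<lambda>u. u = ?u) \<sigma>"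
        using v by (metis hd_play_stack)
      have play': "\<sigma> \<in> plays A" using \<sigma>(2) by (simp add: R_def plays_def)
      have "consistent A i S \<sigma>"
        using \<sigma>(2) by (simp add: consistent_memoryless[OF assms(1,3) play'] R_def)
      then have "won_by Obj i \<sigma>" using win play' \<sigma>(1) by (simp add: winning_from_def)
      \<comment> \<open>The lasso closes only the bad cycle, so greediness awards it to the
        opponent.\<close>
      moreover have "closings_satisfy (good_cycle A Y (opponent i)) \<sigma>"
        using \<sigma>(3) bad by (simp add: closings_satisfy_def good_cycle_opponent)
      then have "won_by Obj (opponent i) \<sigma>" by (rule greedy_won[OF assms(1,2) play'])
      ultimately show False by (simp add: won_by_opponent)
    qed
  qed
next
  assume "\<forall>\<pi>\<in>plays A. \<pi> 0 = v \<and> consistent A i S \<pi> \<longrightarrow> closings_satisfy (good_cycle A Y i) \<pi>"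
  then show "winning_from A Obj i S v"
    using greedy_won[OF assms(1,2)] by (simp add: winning_from_def)
qed

theorem theorem3:
  fixes A :: "('v, 'u) arena"
    and Y :: "'u list set"
    and Obj :: "(nat \<Rightarrow> 'v) set"
    and i :: player
  assumes "is_arena A"
    and "Y \<subseteq> lists (labels A)"
    and "Obj \<subseteq> plays A"
    and "greedy A Y Obj"
  shows "winning_region A Obj i = winning_region A (first_cycle_objective A Y) i \<and>
    (\<forall>v\<in>verts A. \<forall>S. is_strategy A i S \<and> memoryless A i S \<longrightarrow>
       (winning_from A Obj i S v \<longleftrightarrow>
        winning_from A (first_cycle_objective A Y) i S v))"
  using greedy_winning_region[OF assms(1,4)] greedy_memoryless_winning[OF assms(1,4)]
    greedy_winning_region[OF assms(1) greedy_first_cycle[OF assms(1)]]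
    greedy_memoryless_winning[OF assms(1) greedy_first_cycle[OF assms(1)]]
  by simp

end
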